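(* Let $q_1$ be a power of $2$ (with $q_1\ge2$), $q=q_1^2$, and let $m$ be even (and positive). Let $n=q^m-1$ and let $\beta$ be a primitive $n$-th root of unity in $\mathbb{F}_{q^m}$. Put $\delta=q_1^{m+1}-2q_1^2+1$ and assume $\delta\ge 2$. Let $g^{\perp_H}(x)$ be the generator polynomial of the Hermitian dual $\mathcal{C}_{(q,n,\delta,1,\beta)}^{\perp_H}$ of the BCH code $\mathcal{C}_{(q,n,\delta,1,\beta)}$, and let $\mathbf{T}_{g^{\perp_H}}=\{i\in\{0,1,\dots,n-1\}:g^{\perp_H}(\beta^i)=0\}$ be its defining set. Then (i) if $m\ge 4$, $\{0,1,\dots,q_1^{m+1}-q_1^2\}\cup\{q_1^{m+1},q_1^{m+1}+1,\dots,2q_1^{m+1}-q_1^2\}\subseteq\mathbf{T}_{g^{\perp_H}}$; (ii) if $q_1\ge4$ and $m=2$, $\{0,1,\dots,q_1^3-q_1^2+2q_1-1\}\cup\{q_1^3,q_1^3+1,\dots,2q_1^3-q_1^2+2q_1-1\}\subseteq\mathbf{T}_{g^{\perp_H}}$.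
   Context: For $q=q_1^2$, the Hermitian inner product on $\mathbb{F}_q^n$ is $\langle x,y\rangle_H=\sum_i x_iy_i^{q_1}$, and the Hermitian dual of a linear code $\mathcal{C}\subseteq\mathbb{F}_q^n$ is $\mathcal{C}^{\perp_H}=\{c\in\mathbb{F}_q^n:\langle c,y\rangle_H=0\ \forall y\in\mathcal{C}\}$. A cyclic code of length $n$ over $\mathbb{F}_q$ is identified with an ideal of $\mathbb{F}_q[x]/\langle x^n-1\rangle$; its generator polynomial is the unique monic divisor of $x^n-1$ generating it. For $\gcd(n,q)=1$ and $\beta$ a primitive $n$-th root of unity, $m_{\beta^i}(x)$ denotes the minimal polynomial of $\beta^i$ over $\mathbb{F}_q$. For integers $\delta\ge2$ and $b$, the BCH code $\mathcal{C}_{(q,n,\delta,b,\beta)}$ is the cyclic code of length $n$ over $\mathbb{F}_q$ with generator polynomial $\mathrm{lcm}\{m_{\beta^b}(x),\dots,m_{\beta^{b+\delta-2}}(x)\}$. *)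

theory Defs
  imports
    "HOL-Computational_Algebra.Computational_Algebra"
    "HOL-Library.Cardinality"
    "Jordan_Normal_Form.Matrix"
begin

definition primitive_root_of_unity :: "nat \<Rightarrow> 'b::field \<Rightarrow> bool" where
  "primitive_root_of_unity n \<beta> \<longleftrightarrow> \<beta> ^ n = 1 \<and> (\<forall>k. 0 < k \<and> k < n \<longrightarrow> \<beta> ^ k \<noteq> 1)"

text \<open>In what follows, a map \<open>emb :: 'a \<Rightarrow> 'b\<close> is the inclusion of the base field into the
  extension field in which the roots of unity live.\<close>

definition min_poly :: "('a::field \<Rightarrow> 'b::field) \<Rightarrow> 'b \<Rightarrow> 'a poly" where
  "min_poly emb \<alpha> = (THE p. lead_coeff p = 1 \<and> poly (map_poly emb p) \<alpha> = 0 \<and>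
     (\<forall>r. r \<noteq> 0 \<and> poly (map_poly emb r) \<alpha> = 0 \<longrightarrow> degree p \<le> degree r))"

text \<open>The constant \<^const>\<open>Lcm\<close> on polynomials is only available if the coefficient type
  has sort \<open>field_gcd\<close>. The following monic least common multiple makes sense over every
  field; the lemma below shows that it agrees with \<^const>\<open>Lcm\<close> where both are available.\<close>

definition monic_Lcm :: "'a::field poly set \<Rightarrow> 'a poly" where
  "monic_Lcm S = (THE l. lead_coeff l = 1 \<and> (\<forall>p\<in>S. p dvd l) \<and>
     (\<forall>r. (\<forall>p\<in>S. p dvd r) \<longrightarrow> l dvd r))"

lemma monic_Lcm_eq_Lcm:
  fixes S :: "'a::field_gcd poly set"
  assumes "finite S" "0 \<notin> S"
  shows "monic_Lcm S = Lcm S"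
  unfolding monic_Lcm_def
proof (rule the_equality)
  have "Lcm S \<noteq> 0"
    using assms by (simp add: Lcm_0_iff)
  moreover have "normalize (Lcm S) = Lcm S"
    by simp
  moreover have "unit_factor (lead_coeff (Lcm S)) = lead_coeff (Lcm S)"
    using calculation(1) by (intro is_unit_unit_factor) (simp add: dvd_field_iff)
  ultimately have "lead_coeff (Lcm S) = 1"
    by (metis coeff_normalize div_self leading_coeff_0_iff)
  then show "lead_coeff (Lcm S) = 1 \<and> (\<forall>p\<in>S. p dvd Lcm S) \<and>
      (\<forall>r. (\<forall>p\<in>S. p dvd r) \<longrightarrow> Lcm S dvd r)"
    by (auto intro: dvd_Lcm Lcm_least)
next
  fix l assume l: "lead_coeff l = 1 \<and> (\<forall>p\<in>S. p dvd l) \<and>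
    (\<forall>r. (\<forall>p\<in>S. p dvd r) \<longrightarrow> l dvd r)"
  then have "l dvd Lcm S" "Lcm S dvd l"
    by (auto intro: dvd_Lcm Lcm_least)
  then have "normalize l = Lcm S"
    using associatedI[of l "Lcm S"] by simp
  moreover have "normalize l = l"
    using l by (simp add: normalize_poly_eq_map_poly)
  ultimately show "l = Lcm S" by simp
qed

text \<open>A word \<open>c = (c\<^sub>0, \<dots>, c\<^sub>n\<^sub>-\<^sub>1)\<close> is identified with the class of
  \<open>c\<^sub>0 + c\<^sub>1 x + \<dots> + c\<^sub>n\<^sub>-\<^sub>1 x\<^sup>n\<^sup>-\<^sup>1\<close> modulo \<open>x\<^sup>n - 1\<close>, and the quotient ring is represented
  by the remainders modulo \<open>x\<^sup>n - 1\<close>. So \<open>ideal_code n g\<close> is the ideal generated by the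
  class of \<open>g\<close>.\<close>

definition ideal_code :: "nat \<Rightarrow> 'a::field poly \<Rightarrow> 'a vec set" where
  "ideal_code n g = {c \<in> carrier_vec n. \<exists>f. Poly (list_of_vec c) = (f * g) mod (monom 1 n - 1)}"

definition generator_poly :: "nat \<Rightarrow> 'a::field vec set \<Rightarrow> 'a poly" where
  "generator_poly n C = (THE g. lead_coeff g = 1 \<and> g dvd monom 1 n - 1 \<and> C = ideal_code n g)"

definition bch_code ::
  "('a::field \<Rightarrow> 'b::field) \<Rightarrow> nat \<Rightarrow> int \<Rightarrow> int \<Rightarrow> 'b \<Rightarrow> 'a vec set" where
  "bch_code emb n \<delta> b \<beta> =
     ideal_code n (monic_Lcm ((\<lambda>i. min_poly emb (\<beta> powi i)) ` {b..b + \<delta> - 2}))"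

definition hermitian_prod :: "nat \<Rightarrow> 'a::field vec \<Rightarrow> 'a vec \<Rightarrow> 'a" where
  "hermitian_prod q1 x y = (\<Sum>i<dim_vec y. x $ i * (y $ i) ^ q1)"

definition hermitian_dual :: "nat \<Rightarrow> nat \<Rightarrow> 'a::field vec set \<Rightarrow> 'a vec set" where
  "hermitian_dual q1 n C = {c \<in> carrier_vec n. \<forall>y\<in>C. hermitian_prod q1 c y = 0}"

definition defining_set :: "('a::field \<Rightarrow> 'b::field) \<Rightarrow> nat \<Rightarrow> 'b \<Rightarrow> 'a poly \<Rightarrow> nat set" where
  "defining_set emb n \<beta> g = {i \<in> {0..<n}. poly (map_poly emb g) (\<beta> ^ i) = 0}"

end

theory Submission
  imports Defs "Jordan_Normal_Form.Char_Poly"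
begin

text \<open>The Hermitian dual of the code with zero set \<open>B\<close> is again given by its zeros: it consists of
  the words vanishing at all \<open>z \<noteq> 0\<close> such that, for every \<open>l\<close>, the inverse of \<open>z\<close> to the power
  \<open>q1\<^sup>2\<^sup>l\<^sup>+\<^sup>1\<close> is not in \<open>B\<close>. Hence \<open>i\<close> belongs to the defining set as soon as no congruence
  \<open>i q1\<^sup>r + t \<equiv> 0\<close> modulo \<open>n = q1\<^sup>2\<^sup>m - 1\<close> holds with \<open>r\<close> odd and \<open>0 < t < \<delta>\<close>. Such a congruence
  says that the rotation of the base-\<open>q1\<close> digits of \<open>i\<close> by \<open>r\<close> places starts with \<open>m - 1\<close> digits
  \<open>q1 - 1\<close>. For \<open>i\<close> in the stated ranges, the zeros at the top of \<open>i\<close> only leave the rotations by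
  \<open>m - 1\<close> and \<open>m + 1\<close>, as \<open>r\<close> is odd, and in these cases \<open>t\<close> would have to be too large.\<close>

subsection \<open>Arithmetic of digit rotations\<close>

text \<open>Multiplication by \<open>Q\<^sup>s\<close> modulo \<open>Q\<^sup>2\<^sup>m - 1\<close> rotates the \<open>2m\<close> base-\<open>Q\<close> digits: it exchanges the
  upper part \<open>a\<close> and the lower part \<open>b\<close> of \<open>i\<close>.\<close>

lemma multiple_rotation:
  fixes Q m s i t :: nat
  assumes "s \<le> 2 * m" "i < Q ^ (2 * m)" "0 < t" "t < Q ^ (2 * m) - 1"
    and dvd: "(Q ^ (2 * m) - 1) dvd (i * Q ^ s + t)"
  obtains a b where "i = a * Q ^ (2 * m - s) + b" "b < Q ^ (2 * m - s)"
    "b * Q ^ s + a + t + 1 = Q ^ (2 * m)"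
proof -
  define D where "D = Q ^ (2 * m - s)"
  define a b where "a = i div D" and "b = i mod D"
  have N: "Q ^ (2 * m) = D * Q ^ s"
    using assms(1) by (simp add: D_def flip: power_add)
  have "0 < D * Q ^ s"
    using assms(4) N by linarith
  then have D: "0 < D" and Qs: "0 < Q ^ s"
    by (simp_all only: nat_0_less_mult_iff)
  have i: "i = a * D + b" and b: "b < D"
    using D by (simp_all add: a_def b_def)
  have "a < Q ^ s"
    using assms(2) N D unfolding a_def by (simp add: less_mult_imp_div_less mult.commute)
  have "b * Q ^ s + Q ^ s \<le> D * Q ^ s"
    using b by (metis Suc_leI add.commute mult_Suc mult_le_mono1)
  then have bound: "b * Q ^ s + a < D * Q ^ s"
    using \<open>a < Q ^ s\<close> by linarith
  define M where "M = Q ^ (2 * m) - 1"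
  have M: "D * Q ^ s = M + 1"
    using \<open>0 < D * Q ^ s\<close> N by (simp add: M_def)
  have "i * Q ^ s + t = a * (D * Q ^ s) + b * Q ^ s + t"
    using i by (simp add: algebra_simps)
  also have "\<dots> = a * M + (b * Q ^ s + a + t)"
    using M by simp
  finally have "M dvd b * Q ^ s + a + t"
    using dvd by (metis M_def dvd_add_right_iff dvd_triv_right)
  then obtain k where k: "b * Q ^ s + a + t = M * k"
    by (elim dvdE)
  \<comment> \<open>The rotated number is at most \<open>M\<close> and \<open>0 < t < M\<close>, so
    the sum is a positive multiple of \<open>M\<close> below \<open>2 * M\<close>.\<close>
  have "M * k < M * 2" "0 < M * k"
    using bound M assms(3,4) k[symmetric] M_def by auto
  then have "k = 1"
    by (auto simp: nat_less_iff)
  then have "b * Q ^ s + a + t + 1 = Q ^ (2 * m)"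
    using k M N by simp
  with that i b show thesis
    by (simp add: D_def)
qed

text \<open>The digit \<open>e\<close> lets both index ranges be treated at once. As
  \<open>m\<close> is even and \<open>s\<close> odd, \<open>s\<close> is never \<open>m - 2\<close>,
  \<open>m\<close> or \<open>m + 2\<close>. The extreme values of \<open>s\<close> fail by order of
  magnitude; \<open>m - 1\<close> and \<open>m + 1\<close> fail by the gaps \<open>Q\<^sup>2\<close>
  for \<open>j\<close> and \<open>2 * Q\<^sup>2\<close> for \<open>t\<close>.\<close>

lemma rotation_avoids_low_range:
  fixes Q m s e j t :: nat
  assumes "2 \<le> Q" "4 \<le> m" "even m" "odd s" "s < 2 * m"
    and e: "e \<le> 1" and j: "j + Q\<^sup>2 \<le> Q ^ (m + 1)"
    and t: "0 < t" "t + 2 * Q\<^sup>2 \<le> Q ^ (m + 1)"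
  shows "\<not> (Q ^ (2 * m) - 1) dvd ((e * Q ^ (m + 1) + j) * Q ^ s + t)"
proof
  assume dvd: "(Q ^ (2 * m) - 1) dvd ((e * Q ^ (m + 1) + j) * Q ^ s + t)"
  define R where "R = Q ^ (m - 1)"
  define i where "i = e * Q ^ (m + 1) + j"
  have R: "Q ^ (m + 1) = R * Q\<^sup>2" "Q ^ (2 * m) = R * R * Q\<^sup>2"
  proof -
    have "Q ^ (m + 1) = Q ^ (m - 1 + 2)" "Q ^ (2 * m) = Q ^ (m - 1 + (m - 1) + 2)"
      using \<open>4 \<le> m\<close> by (intro arg_cong[of _ _ "(^) Q"]; simp)+
    then show "Q ^ (m + 1) = R * Q\<^sup>2" "Q ^ (2 * m) = R * R * Q\<^sup>2"
      by (simp_all only: R_def power_add)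
  qed
  have Q2: "4 \<le> Q\<^sup>2"
    using power_mono[OF \<open>2 \<le> Q\<close>, of 2] by simp
  have "Q ^ 3 \<le> R"
    unfolding R_def using \<open>4 \<le> m\<close> \<open>2 \<le> Q\<close> by (intro power_increasing) auto
  then have R8: "8 \<le> R"
    using power_mono[OF \<open>2 \<le> Q\<close>, of 3] by simp
  have i: "i + Q\<^sup>2 \<le> 2 * (R * Q\<^sup>2)"
    using mult_le_mono1[OF e, of "R * Q\<^sup>2"] j unfolding i_def R by linarith
  have "8 * (R * Q\<^sup>2) \<le> R * R * Q\<^sup>2"
    using R8 by simp
  moreover have "32 \<le> R * Q\<^sup>2"
    using mult_le_mono[OF R8 Q2] by simp
  ultimately have "i < Q ^ (2 * m)" "t < Q ^ (2 * m) - 1"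
    using i t R Q2 by linarith+
  then obtain a b where ab: "i = a * Q ^ (2 * m - s) + b" "b < Q ^ (2 * m - s)"
      "b * Q ^ s + a + t + 1 = Q ^ (2 * m)"
    using multiple_rotation[of s m i Q t] dvd \<open>s < 2 * m\<close> t(1) by (auto simp: i_def)
  \<comment> \<open>Together with the identity in \<open>ab\<close> this gives
    \<open>Q ^ s \<le> a + t + 1\<close>, a lower bound for \<open>a\<close> once \<open>s\<close>
    exceeds \<open>m\<close>.\<close>
  have bs: "b * Q ^ s + Q ^ s \<le> Q ^ (2 * m)"
  proof -
    have "(b + 1) * Q ^ s \<le> Q ^ (2 * m - s) * Q ^ s"
      using ab(2) by (intro mult_right_mono) auto
    then show ?thesis
      using \<open>s < 2 * m\<close> by (simp flip: power_add)
  qed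
  consider "s + 3 \<le> m" | "s + 1 = m" | "s = m + 1" | "m + 3 \<le> s"
    using \<open>even m\<close> \<open>odd s\<close> by (metis One_nat_def Suc_eq_plus1 Suc_leI add.commute
      add_Suc_right even_add even_plus_one_iff le_antisym not_less_eq_eq numeral_3_eq_3 odd_one
      plus_1_eq_Suc)
  then show False
  proof cases
    \<comment> \<open>The rotation is a plain shift here: \<open>i * Q ^ s\<close> is at most half
      of \<open>Q ^ (2 * m)\<close> and \<open>t\<close> at most an eighth.\<close>
    case 1
    then have "Q ^ (m + 1) * Q\<^sup>2 \<le> Q ^ (2 * m - s)"
      using \<open>2 \<le> Q\<close> unfolding power_add[symmetric] by (intro power_increasing) auto
    moreover have "4 * (R * Q\<^sup>2) \<le> Q ^ (m + 1) * Q\<^sup>2"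
      using mult_right_mono[OF Q2, of "R * Q\<^sup>2"] R by (simp add: mult_ac)
    ultimately have "i < Q ^ (2 * m - s)"
      using i Q2 by linarith
    then have "a = 0" "b = i"
      using ab(1) by (cases a; simp)+
    then have "i * Q ^ s + t + 1 = R * R * Q\<^sup>2"
      using ab(3) R by simp
    moreover have "Q ^ s * Q\<^sup>2 \<le> R"
      using 1 \<open>2 \<le> Q\<close> unfolding R_def power_add[symmetric] by (intro power_increasing) auto
    then have "i * (Q ^ s * Q\<^sup>2) \<le> 2 * (R * Q\<^sup>2) * R"
      using i by (intro mult_le_mono) auto
    then have "i * Q ^ s \<le> 2 * R * R"
      using \<open>2 \<le> Q\<close> by (simp add: mult_ac)
    moreover have "4 * (R * R) \<le> R * R * Q\<^sup>2"
      using mult_right_mono[OF Q2, of "R * R"] by (simp add: mult_ac)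
    moreover have "8 * (R * Q\<^sup>2) \<le> R * R * Q\<^sup>2"
      using R8 by simp
    ultimately show False
      using t(2) R \<open>32 \<le> R * Q\<^sup>2\<close> by linarith
  next
    \<comment> \<open>The gap \<open>Q\<^sup>2\<close> above \<open>j\<close> is scaled by
      \<open>R\<close> to \<open>R * Q\<^sup>2\<close>, more than \<open>e + t + 1\<close> can
      fill.\<close>
    case 2
    then have "2 * m - s = m + 1" "Q ^ s = R"
      by (auto simp: R_def)
    then have eq: "a * (R * Q\<^sup>2) + b = e * (R * Q\<^sup>2) + j" "b < R * Q\<^sup>2" "j < R * Q\<^sup>2"
      using ab j R Q2 by (auto simp: i_def)
    then have "a = e" "b = j"
      by (metis div_mult_self3 add_0_right div_less gr_implies_not0, 
          metis mod_mult_self3 mod_less)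
    have "(b + Q\<^sup>2) * R \<le> (R * Q\<^sup>2) * R"
      using \<open>b = j\<close> j R by (intro mult_right_mono) auto
    then have "b * R + R * Q\<^sup>2 \<le> R * R * Q\<^sup>2"
      by (simp add: algebra_simps)
    moreover have "b * R + e + t + 1 = R * R * Q\<^sup>2"
      using ab(3) \<open>Q ^ s = R\<close> \<open>a = e\<close> R by simp
    ultimately show False
      using e t(2) R Q2 by linarith
  next
    case 3
    then have s: "2 * m - s = m - 1" "Q ^ s = R * Q\<^sup>2"
      using R by auto
    have "2 * Q\<^sup>2 \<le> a + 1"
      using ab(3) bs s t(2) R by linarith
    \<comment> \<open>The bound on \<open>i\<close> forces equality. Then \<open>b\<close> is at
      least \<open>R - 1\<close>, so \<open>i\<close> is at least
      \<open>2 * (R * Q\<^sup>2) - 1\<close>, which is too large.\<close>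
    then have "2 * Q\<^sup>2 = a + 1"
    proof -
      have "a * R < 2 * (R * Q\<^sup>2)"
        using i Q2 unfolding ab(1) s(1) R_def by linarith
      then have "a * R < 2 * Q\<^sup>2 * R"
        by (simp add: mult_ac)
      then show ?thesis
        using \<open>2 * Q\<^sup>2 \<le> a + 1\<close> by simp
    qed
    then have "(a + 1) * R = 2 * (R * Q\<^sup>2)"
      by (metis mult.assoc mult.commute)
    moreover have "R \<le> b + 1"
    proof -
      have "R * (R * Q\<^sup>2) < (b + 2) * (R * Q\<^sup>2)"
        using ab(3) s \<open>2 * Q\<^sup>2 = a + 1\<close> t(2) R \<open>32 \<le> R * Q\<^sup>2\<close> by (simp add: algebra_simps)
      then have "R < b + 2"
        using mult_less_cancel2 by blast
      then show ?thesis
        by simp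
    qed
    ultimately show False
      using ab(1) s i Q2 by (simp add: R_def algebra_simps)
  next
    case 4
    then have "Q ^ (m + 1) * Q\<^sup>2 \<le> Q ^ s"
      using \<open>2 \<le> Q\<close> unfolding power_add[symmetric] by (intro power_increasing) auto
    moreover have "4 * (R * Q\<^sup>2) \<le> Q ^ (m + 1) * Q\<^sup>2"
      using mult_right_mono[OF Q2, of "R * Q\<^sup>2"] R by (simp add: mult_ac)
    moreover have "a \<le> i"
      using ab \<open>2 \<le> Q\<close> by (simp add: trans_le_add1)
    ultimately show False
      using ab(3) bs i t(2) R Q2 by linarith
  qed
qed

text \<open>For \<open>m = 2\<close> only \<open>s = 1\<close> and \<open>s = 3\<close> occur, and
  \<open>j\<close> may go further by \<open>2 * Q - 1\<close>. For \<open>s = 1\<close> the gap left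
  by \<open>j * Q\<close> is at least \<open>Q ^ 3 - 2 * Q\<^sup>2 + Q\<close>, more than
  \<open>e + t + 1\<close>. For \<open>s = 3\<close>, \<open>i\<close> would be at least
  \<open>2 * Q ^ 3 - Q\<close>.\<close>

lemma rotation_avoids_low_range_2:
  fixes Q s e j t :: nat
  assumes "4 \<le> Q" "odd s" "s < 4"
    and e: "e \<le> 1" and j: "j + Q\<^sup>2 + 1 \<le> Q ^ 3 + 2 * Q"
    and t: "0 < t" "t + 2 * Q\<^sup>2 \<le> Q ^ 3"
  shows "\<not> (Q ^ 4 - 1) dvd ((e * Q ^ 3 + j) * Q ^ s + t)"
proof
  assume dvd: "(Q ^ 4 - 1) dvd ((e * Q ^ 3 + j) * Q ^ s + t)"
  define i where "i = e * Q ^ 3 + j"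
  have Q: "Q ^ 4 = Q * Q ^ 3" "Q ^ 3 = Q * Q\<^sup>2" "Q\<^sup>2 = Q * Q"
    by (simp_all add: power_numeral_reduce)
  have Q2: "4 * Q \<le> Q\<^sup>2" "4 * Q\<^sup>2 \<le> Q ^ 3" "4 * Q ^ 3 \<le> Q ^ 4"
    using \<open>4 \<le> Q\<close> Q by (auto simp: mult_le_mono)
  have i: "i + Q\<^sup>2 + 1 \<le> 2 * Q ^ 3 + 2 * Q"
    using mult_le_mono1[OF e, of "Q ^ 3"] j unfolding i_def by linarith
  have "i < Q ^ 4" "t < Q ^ 4 - 1"
    using i t Q2 \<open>4 \<le> Q\<close> by linarith+
  then obtain a b where ab: "i = a * Q ^ (4 - s) + b" "b < Q ^ (4 - s)"
      "b * Q ^ s + a + t + 1 = Q ^ 4"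
    using multiple_rotation[of s 2 i Q t] dvd \<open>s < 4\<close> t(1) by (auto simp: i_def)
  have "s = 1 \<or> s = 3"
    using \<open>odd s\<close> \<open>s < 4\<close> by (auto elim!: oddE)
  then show False
  proof
    assume s: "s = 1"
    then have eq: "a * Q ^ 3 + b = e * Q ^ 3 + j" "b < Q ^ 3" "j < Q ^ 3"
      using ab j Q2 \<open>4 \<le> Q\<close> by (auto simp: i_def)
    then have "a = e" "b = j"
      by (metis div_mult_self3 add_0_right div_less gr_implies_not0, 
          metis mod_mult_self3 mod_less)
    have "(b + Q\<^sup>2 + 1) * Q \<le> (Q ^ 3 + 2 * Q) * Q"
      using \<open>b = j\<close> j by (intro mult_right_mono) auto
    then have "b * Q + Q ^ 3 + Q \<le> Q ^ 4 + 2 * Q\<^sup>2"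
      by (simp add: algebra_simps Q)
    then show False
      using ab(3) s \<open>a = e\<close> e t(2) \<open>4 \<le> Q\<close> by simp
  next
    assume s: "s = 3"
    have "(b + 1) * Q ^ 3 \<le> Q * Q ^ 3"
      using ab(2) s by (intro mult_right_mono) auto
    then have "2 * Q\<^sup>2 \<le> a + 1"
      using ab(3) s t(2) Q(1) by simp
    then have "2 * Q\<^sup>2 * Q \<le> (a + 1) * Q"
      by (intro mult_right_mono) auto
    then show False
      using ab(1) s i Q2 by (simp add: Q(2) algebra_simps)
  qed
qed

subsection \<open>Finite fields\<close>

text \<open>Multiplication by \<open>x\<close> permutes the nonzero elements, so comparing their
  products before and after gives the claim.\<close>

lemma finite_field_power_card_minus_1:
  fixes x :: "'a::{field,finite}"
  assumes "x \<noteq> 0"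
  shows "x ^ (CARD('a) - 1) = 1"
proof -
  have "bij_betw ((*) x) (- {0}) (- {0})"
    using assms by (intro bij_betw_byWitness[of _ "\<lambda>y. y / x"]) auto
  then have "(\<Prod>y\<in>- {0}. x * y) = \<Prod>(- {0})"
    by (rule prod.reindex_bij_betw)
  moreover have "(\<Prod>y\<in>- {0}. x * y) = x ^ (CARD('a) - 1) * \<Prod>(- {0})"
    by (simp add: prod.distrib Compl_eq_Diff_UNIV card_Diff_singleton)
  moreover have "\<Prod>(- {0::'a}) \<noteq> 0"
    by (simp add: prod_zero_iff)
  ultimately show ?thesis
    by simp
qed

lemma finite_field_power_card:
  fixes x :: "'a::{field,finite}"
  shows "x ^ CARD('a) = x"
proof (cases "x = 0")
  case False
  have "x ^ CARD('a) = x * x ^ (CARD('a) - 1)"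
    by (simp flip: power_Suc)
  with False show ?thesis
    by (metis finite_field_power_card_minus_1 mult.right_neutral)
qed simp

lemma finite_field_power_card_power:
  fixes x :: "'a::{field,finite}"
  shows "x ^ (CARD('a) ^ k) = x"
  by (induction k) (simp_all add: power_mult finite_field_power_card)

text \<open>The multiplicative group has odd order, so the corresponding power of \<open>- 1\<close>
  is both \<open>- 1\<close> and \<open>1\<close>.\<close>

lemma two_eq_0_if_even_card:
  assumes "even CARD('a::{field,finite})"
  shows "(2::'a) = 0"
proof -
  have "odd (CARD('a) - 1)"
    using assms by simp
  then have "(- 1 :: 'a) ^ (CARD('a) - 1) = - 1"
    by simp
  then have "(1::'a) = - 1"
    using finite_field_power_card_minus_1[of "- 1 :: 'a"] by simp
  then show ?thesis
    by (metis add.right_inverse one_add_one)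
qed

lemma add_power_two_power:
  fixes x y :: "'a::comm_ring_1"
  assumes "(2::'a) = 0"
  shows "(x + y) ^ (2 ^ k) = x ^ (2 ^ k) + y ^ (2 ^ k)"
proof (induction k arbitrary: x y)
  case (Suc k)
  have "(x + y)\<^sup>2 = x\<^sup>2 + y\<^sup>2"
    using assms by (simp add: power2_sum)
  then show ?case
    using Suc by (simp add: power_mult)
qed simp

lemma sum_power_two_power:
  fixes f :: "'i \<Rightarrow> 'a::comm_ring_1"
  assumes "(2::'a) = 0"
  shows "(\<Sum>i\<in>A. f i) ^ (2 ^ k) = (\<Sum>i\<in>A. f i ^ (2 ^ k))"
proof (induction A rule: infinite_finite_induct)
  case (insert i A)
  then show ?case
    using add_power_two_power[OF assms, of "f i" "sum f A" k] by simp
qed (simp_all add: power_0_left)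

lemma card_poly_roots_le:
  fixes p :: "'a::idom poly"
  assumes "p \<noteq> 0" "\<And>x. x \<in> A \<Longrightarrow> poly p x = 0"
  shows "card A \<le> degree p"
proof -
  have "card A \<le> card {x. poly p x = 0}"
    using assms by (intro card_mono poly_roots_finite) auto
  also have "\<dots> \<le> degree p"
    using assms(1) by (rule card_poly_roots_bound)
  finally show ?thesis .
qed

text \<open>The polynomial \<open>X^q - X\<close> with \<open>q = CARD('a)\<close> has at most
  \<open>q\<close> roots, and the image of \<open>emb\<close> already supplies that many.\<close>

lemma frobenius_fixed_in_range:
  fixes emb :: "'a::{field,finite} \<Rightarrow> 'b::field"
  assumes "field_hom emb" "z ^ CARD('a) = z"
  shows "z \<in> range emb"
proof (rule ccontr)
  interpret field_hom emb by fact
  assume "z \<notin> range emb"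
  have "1 < CARD('a)"
    using card_mono[of UNIV "{0, 1 :: 'a}"] by simp
  define p :: "'b poly" where "p = monom 1 CARD('a) - monom 1 1"
  have deg: "degree p \<le> CARD('a)"
    using \<open>1 < CARD('a)\<close> unfolding p_def by (intro degree_diff_le) (auto simp: degree_monom_eq)
  have "coeff p 1 \<noteq> 0"
    using \<open>1 < CARD('a)\<close> by (simp add: p_def)
  then have "p \<noteq> 0"
    by auto
  have "poly p x = 0" if "x \<in> insert z (range emb)" for x
    using that assms(2) by (auto simp: p_def poly_monom finite_field_power_card simp flip: hom_power)
  from card_poly_roots_le[OF \<open>p \<noteq> 0\<close> this] have "card (insert z (range emb)) \<le> CARD('a)"
    using deg by (rule le_trans)
  moreover have "card (range emb) = CARD('a)"
    by (simp add: card_image inj_on_def)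
  ultimately show False
    using \<open>z \<notin> range emb\<close> by simp
qed

text \<open>For \<open>w \<noteq> 0\<close> the products \<open>a * w\<close> exhaust the field, so
  the trace polynomial, which is nonzero of degree below \<open>q ^ m\<close>, would have
  \<open>q ^ m\<close> roots.\<close>

lemma trace_form_nondegenerate:
  fixes w :: "'b::{field,finite}"
  assumes "CARD('b) = q ^ m" "0 < m" "1 < q"
    and "\<And>a. (\<Sum>l<m. (a * w) ^ (q ^ l)) = 0"
  shows "w = 0"
proof (rule ccontr)
  assume "w \<noteq> 0"
  define p :: "'b poly" where "p = (\<Sum>l<m. monom 1 (q ^ l))"
  have "degree p \<le> q ^ (m - 1)"
    unfolding p_def using assms(3)
    by (intro degree_sum_le) (auto intro!: power_increasing simp: degree_monom_eq)
  also have "\<dots> < q ^ m"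
    using assms(2,3) by (intro power_strict_increasing) auto
  finally have "degree p < q ^ m" .
  moreover have "coeff p 1 = (\<Sum>l<m. if l = 0 then 1 else 0)"
    using assms(3) by (auto simp: p_def coeff_sum intro!: sum.cong)
  then have "p \<noteq> 0"
    using assms(2) by auto
  moreover have "poly p x = 0" for x
    using assms(4)[of "x / w"] \<open>w \<noteq> 0\<close> by (simp add: p_def poly_sum poly_monom)
  ultimately show False
    using card_poly_roots_le[of p UNIV] assms(1) by simp
qed

lemma sum_powers_root_of_unity:
  fixes z :: "'a::field"
  assumes "z ^ n = 1" "z \<noteq> 1"
  shows "(\<Sum>k<n. z ^ k) = 0"
  using assms geometric_sum[of z n] by simp

text \<open>Since \<open>X^j - 1\<close> has too few roots, some nonzero \<open>w\<close> has
  \<open>w ^ j \<noteq> 1\<close>; substituting \<open>w * z\<close> for \<open>z\<close> multiplies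
  the sum by \<open>w ^ j\<close> without changing it.\<close>

lemma sum_nonzero_power_eq_0:
  assumes "0 < j" "j < CARD('a::{field,finite}) - 1"
  shows "(\<Sum>z\<in>- {0::'a}. z ^ j) = 0"
proof -
  define p :: "'a poly" where "p = monom 1 j - 1"
  have "coeff p j \<noteq> 0"
    using assms(1) by (simp add: p_def)
  then have "p \<noteq> 0"
    by auto
  have "degree p \<le> j"
    unfolding p_def by (intro degree_diff_le) (auto simp: degree_monom_eq)
  then have "degree p < card (- {0::'a})"
    using assms(2) by (simp add: Compl_eq_Diff_UNIV card_Diff_singleton)
  then obtain w where w: "w \<in> - {0}" "poly p w \<noteq> 0"
    using card_poly_roots_le[OF \<open>p \<noteq> 0\<close>, of "- {0}"] by (meson leD)
  have "bij_betw ((*) w) (- {0}) (- {0})"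
    using w by (intro bij_betw_byWitness[of _ "\<lambda>y. y / w"]) auto
  then have "(\<Sum>z\<in>- {0}. (w * z) ^ j) = (\<Sum>z\<in>- {0}. z ^ j)"
    by (rule sum.reindex_bij_betw)
  then have "w ^ j * (\<Sum>z\<in>- {0}. z ^ j) = (\<Sum>z\<in>- {0}. z ^ j)"
    by (simp add: power_mult_distrib sum_distrib_left)
  then show ?thesis
    using w by (simp add: p_def poly_monom)
qed

lemma sum_nonzero_power_orthogonal:
  fixes k l :: nat
  assumes "k < CARD('a::{field,finite}) - 1" "l < CARD('a) - 1"
  shows "(\<Sum>z\<in>- {0::'a}. z ^ k * inverse z ^ l) = (if k = l then - 1 else 0)"
proof -
  let ?n = "CARD('a) - 1"
  \<comment> \<open>Adding the group order \<open>?n\<close> keeps the exponent a natural number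
    when \<open>k < l\<close>.\<close>
  have split: "z ^ k * inverse z ^ l = (if l \<le> k then z ^ (k - l) else z ^ (?n + k - l))"
    if "z \<noteq> 0" for z :: 'a
  proof (cases "l \<le> k")
    case True
    with that show ?thesis
      by (simp add: power_diff divide_inverse power_inverse)
  next
    case False
    then have "z ^ (?n + k - l) = z ^ ?n * z ^ k * inverse z ^ l"
      using that assms by (simp add: power_diff power_add divide_inverse power_inverse)
    with False show ?thesis
      using finite_field_power_card_minus_1[OF that] by simp
  qed
  have "(\<Sum>z\<in>- {0::'a}. z ^ k * inverse z ^ l) =
      (\<Sum>z\<in>- {0::'a}. if l \<le> k then z ^ (k - l) else z ^ (?n + k - l))"
    by (intro sum.cong refl split) auto
  also have "\<dots> = (if k = l then - 1 else 0)"
  proof -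
    \<comment> \<open>Translation by 1 preserves the sum over the field, so \<open>CARD('a)\<close>
      is zero in it and the nonzero elements count as \<open>- 1\<close>.\<close>
    have "bij_betw ((+) 1) (UNIV :: 'a set) UNIV"
      by (intro bij_betw_byWitness[of _ "\<lambda>y. y - 1"]) auto
    then have "(\<Sum>z\<in>UNIV. 1 + z :: 'a) = \<Sum>UNIV"
      by (rule sum.reindex_bij_betw)
    then have "of_nat CARD('a) = (0::'a)"
      by (simp add: sum.distrib)
    then have "of_nat (card (- {0::'a})) = (- 1 :: 'a)"
      by (simp add: Compl_eq_Diff_UNIV card_Diff_singleton of_nat_diff)
    moreover have "l < k \<or> k < l" if "k \<noteq> l"
      using that by auto
    ultimately show ?thesis
      using assms by (auto simp: sum_nonzero_power_eq_0)
  qed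
  finally show ?thesis .
qed

subsection \<open>Ideals of polynomials and cyclic codes\<close>

text \<open>A member of least degree, made monic, divides every other one, since a nonzero remainder
  would be a member of smaller degree. The predicate form covers vanishing conditions as well as
  common multiples.\<close>

lemma poly_ideal_principal:
  fixes P :: "'a::field poly \<Rightarrow> bool"
  assumes "P p0" "p0 \<noteq> 0"
    and diff: "\<And>p r. P p \<Longrightarrow> P r \<Longrightarrow> P (p - r)"
    and mult: "\<And>p r. P p \<Longrightarrow> P (r * p)"
  obtains g where "lead_coeff g = 1" "\<And>p. P p \<longleftrightarrow> g dvd p"
proof -
  obtain h where h: "h \<noteq> 0" "P h" "\<And>p. p \<noteq> 0 \<Longrightarrow> P p \<Longrightarrow> degree h \<le> degree p"
    using ex_has_least_nat[of "\<lambda>p. p \<noteq> 0 \<and> P p" p0 degree] assms(1,2) by blast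
  define g where "g = Polynomial.smult (inverse (lead_coeff h)) h"
  have g: "lead_coeff g = 1" "g \<noteq> 0" "degree g = degree h"
    using h(1) by (auto simp: g_def)
  have "g = [:inverse (lead_coeff h):] * h"
    by (simp add: g_def)
  then have "P g"
    using mult[OF h(2)] by metis
  have "g dvd p" if "P p" for p
  proof (rule ccontr)
    assume "\<not> g dvd p"
    then have "p mod g \<noteq> 0"
      by (simp add: dvd_eq_mod_eq_0)
    moreover have "P (p mod g)"
      using diff[OF that mult[OF \<open>P g\<close>, of "p div g"]] by (simp add: minus_div_mult_eq_mod)
    ultimately show False
      using h(3)[of "p mod g"] degree_mod_less[OF g(2), of p] g(3) by simp
  qed
  moreover have "P p" if "g dvd p" for p
    using that mult[OF \<open>P g\<close>] by (auto elim!: dvdE simp: mult.commute)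
  ultimately have "P p \<longleftrightarrow> g dvd p" for p
    by blast
  with g(1) show thesis
    by (rule that)
qed

lemma monic_dvd_antisym:
  fixes p q :: "'a::field poly"
  assumes "p dvd q" "q dvd p" "lead_coeff p = 1" "lead_coeff q = 1"
  shows "p = q"
proof -
  obtain c where c: "q = p * c"
    using assms(1) by (elim dvdE)
  have "q \<noteq> 0" "p \<noteq> 0"
    using assms(3,4) by auto
  then have "degree c = 0"
    using c assms(2) by (simp add: degree_mult_eq)
  then obtain a where "c = [:a:]"
    by (metis degree_eq_zeroE)
  then have "q = Polynomial.smult a p" "a = 1"
    using c assms(3,4) by (auto split: if_splits)
  then show ?thesis
    by simp
qed

text \<open>The witness \<open>r\<close> makes the ideal of polynomials vanishing at
  \<open>\<alpha>\<close> nonzero; its monic generator is the only polynomial that fits the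
  description in \<open>min_poly\<close>.\<close>

lemma min_poly_dvd_iff:
  fixes emb :: "'a::field \<Rightarrow> 'b::field"
  assumes "field_hom emb" "r \<noteq> 0" "poly (map_poly emb r) \<alpha> = 0"
  shows "min_poly emb \<alpha> dvd p \<longleftrightarrow> poly (map_poly emb p) \<alpha> = 0"
proof -
  interpret field_hom emb by fact
  interpret mp: map_poly_idom_hom emb ..
  obtain g where g: "lead_coeff g = 1" "\<And>p. poly (map_poly emb p) \<alpha> = 0 \<longleftrightarrow> g dvd p"
    by (rule poly_ideal_principal[of "\<lambda>p. poly (map_poly emb p) \<alpha> = 0" r])
      (auto simp: assms(2,3) hom_distribs)
  have "g \<noteq> 0"
    using g(1) by auto
  have "min_poly emb \<alpha> = g"
    unfolding min_poly_def
  proof (rule the_equality)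
    show "lead_coeff g = 1 \<and> poly (map_poly emb g) \<alpha> = 0 \<and>
        (\<forall>r. r \<noteq> 0 \<and> poly (map_poly emb r) \<alpha> = 0 \<longrightarrow> degree g \<le> degree r)"
      using g by (auto simp: dvd_imp_degree_le)
  next
    fix h
    assume h: "lead_coeff h = 1 \<and> poly (map_poly emb h) \<alpha> = 0 \<and>
        (\<forall>r. r \<noteq> 0 \<and> poly (map_poly emb r) \<alpha> = 0 \<longrightarrow> degree h \<le> degree r)"
    then have "degree h \<le> degree g" "g dvd h" "h \<noteq> 0"
      using g \<open>g \<noteq> 0\<close> by auto
    then obtain c where c: "h = g * c"
      by (auto elim: dvdE)
    then have "c \<noteq> 0" "degree c = 0"
      using \<open>h \<noteq> 0\<close> \<open>g \<noteq> 0\<close> \<open>degree h \<le> degree g\<close> by (auto simp: degree_mult_eq)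
    then have "h dvd g"
      using c by (simp add: is_unit_iff_degree)
    with \<open>g dvd h\<close> h g(1) show "h = g"
      by (intro monic_dvd_antisym) auto
  qed
  with g(2) show ?thesis
    by simp
qed

lemma monic_Lcm_dvd_iff:
  fixes S :: "'a::field poly set"
  assumes "r0 \<noteq> 0" "\<And>p. p \<in> S \<Longrightarrow> p dvd r0"
  shows "monic_Lcm S dvd r \<longleftrightarrow> (\<forall>p\<in>S. p dvd r)"
proof -
  obtain g where g: "lead_coeff g = 1" "\<And>r. (\<forall>p\<in>S. p dvd r) \<longleftrightarrow> g dvd r"
    by (rule poly_ideal_principal[of "\<lambda>r. \<forall>p\<in>S. p dvd r" r0]) (auto simp: assms)
  have "monic_Lcm S = g"
    unfolding monic_Lcm_def
    by (rule the_equality) (use g in \<open>auto intro: monic_dvd_antisym\<close>)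
  with g(2) show ?thesis
    by simp
qed

lemma degree_monom_minus_1:
  assumes "0 < n"
  shows "degree (monom 1 n - 1 :: 'a::comm_ring_1 poly) = n"
proof (rule antisym)
  show "degree (monom 1 n - 1 :: 'a poly) \<le> n"
    by (intro degree_diff_le) (auto simp: degree_monom_le)
  show "n \<le> degree (monom 1 n - 1 :: 'a poly)"
    using assms by (intro le_degree) auto
qed

text \<open>Reduction modulo \<open>monom 1 n - 1\<close> preserves divisibility by its divisor
  \<open>g\<close>. Conversely, the polynomial of a word has degree below \<open>n\<close> and is
  its own remainder.\<close>

lemma ideal_code_iff:
  fixes g :: "'a::field poly"
  assumes "g dvd monom 1 n - 1" "0 < n"
  shows "c \<in> ideal_code n g \<longleftrightarrow> c \<in> carrier_vec n \<and> g dvd Poly (list_of_vec c)"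
proof (intro iffI conjI)
  assume "c \<in> ideal_code n g"
  then obtain f where f: "c \<in> carrier_vec n" "Poly (list_of_vec c) = (f * g) mod (monom 1 n - 1)"
    by (auto simp: ideal_code_def)
  then show "c \<in> carrier_vec n" "g dvd Poly (list_of_vec c)"
    using assms(1) by (auto simp: dvd_mod_iff)
next
  assume c: "c \<in> carrier_vec n \<and> g dvd Poly (list_of_vec c)"
  have "coeff (Poly (list_of_vec c)) i = 0" if "i \<ge> n" for i
    using that c by (auto simp: nth_default_def)
  then have "degree (Poly (list_of_vec c)) \<le> n - 1"
    using assms(2) by (intro degree_le) auto
  then have "Poly (list_of_vec c) mod (monom 1 n - 1) = Poly (list_of_vec c)"
    using assms(2) by (intro mod_poly_less) (simp add: degree_monom_minus_1)
  moreover obtain f where "Poly (list_of_vec c) = f * g"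
    using c by (metis dvdE mult.commute)
  ultimately have "Poly (list_of_vec c) = (f * g) mod (monom 1 n - 1)"
    by metis
  with c show "c \<in> ideal_code n g"
    unfolding ideal_code_def by blast
qed

section \<open>Cyclic codes described by zeros, and their Hermitian duals\<close>

definition eval_word :: "('a::field \<Rightarrow> 'b::field) \<Rightarrow> 'a vec \<Rightarrow> 'b \<Rightarrow> 'b" where
  "eval_word emb c z = poly (map_poly emb (Poly (list_of_vec c))) z"

definition zero_code :: "('a::field \<Rightarrow> 'b::field) \<Rightarrow> nat \<Rightarrow> 'b set \<Rightarrow> 'a vec set" where
  "zero_code emb n Z = {c \<in> carrier_vec n. \<forall>z\<in>Z. eval_word emb c z = 0}"

lemma eval_word_eq_sum:
  assumes "field_hom emb" "c \<in> carrier_vec n"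
  shows "eval_word emb c z = (\<Sum>k<n. emb (c $ k) * z ^ k)"
proof -
  interpret field_hom emb by fact
  have "poly (map_poly emb (Poly xs)) z = (\<Sum>k<length xs. emb (xs ! k) * z ^ k)" for xs
  proof (induction xs)
    case (Cons x xs)
    then show ?case
      by (simp add: hom_distribs sum.lessThan_Suc_shift sum_distrib_left mult_ac
          del: sum.lessThan_Suc)
  qed simp
  from this[of "list_of_vec c"] show ?thesis
    using assms(2) by (auto simp: eval_word_def list_of_vec_index)
qed

text \<open>The word of \<open>g\<close> lies in its own code, hence in that of \<open>h\<close>, so
  \<open>h\<close> divides \<open>g\<close>; the situation is symmetric.\<close>

lemma ideal_code_inject:
  fixes g h :: "'a::field poly"
  assumes "g dvd monom 1 n - 1" "h dvd monom 1 n - 1" "0 < n"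
    and "lead_coeff g = 1" "lead_coeff h = 1" "ideal_code n g = ideal_code n h"
  shows "g = h"
proof -
  have "h dvd g" if "g dvd monom 1 n - 1" "h dvd monom 1 n - 1" "ideal_code n g = ideal_code n h"
    for g h :: "'a poly"
  proof -
    \<comment> \<open>The remainder is taken because \<open>g\<close> may be
      \<open>monom 1 n - 1\<close> itself, which stands for the zero word.\<close>
    define r where "r = g mod (monom 1 n - 1)"
    define c where "c = vec n (coeff r)"
    have "degree r < n \<or> r = 0"
      using degree_mod_less[of "monom 1 n - 1" g] \<open>0 < n\<close> degree_monom_minus_1[of n, where ?'a = 'a]
      by (metis r_def degree_0 not_gr0)
    then have "coeff r k = 0" if "n \<le> k" for k
      using that by (auto intro: coeff_eq_0)
    then have "Poly (list_of_vec c) = r"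
      by (intro poly_eqI) (auto simp: c_def nth_default_def)
    moreover have "g dvd r"
      using that(1) by (simp add: r_def dvd_mod_iff)
    moreover have "c \<in> carrier_vec n"
      by (simp add: c_def)
    ultimately have "c \<in> ideal_code n h"
      using ideal_code_iff[OF that(1) \<open>0 < n\<close>] that(3) by simp
    then have "h dvd r"
      using ideal_code_iff[OF that(2) \<open>0 < n\<close>] \<open>Poly (list_of_vec c) = r\<close> by simp
    then show ?thesis
      using that(2) by (simp add: r_def dvd_mod_iff)
  qed
  from this[OF assms(1,2,6)] this[OF assms(2,1) assms(6)[symmetric]] show ?thesis
    using assms(4,5) by (intro monic_dvd_antisym)
qed

text \<open>The polynomials vanishing on \<open>Z\<close> form an ideal containing
  \<open>monom 1 n - 1\<close>. Its monic generator generates the code, and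
  \<open>ideal_code_inject\<close> makes it the value of the definite description.\<close>

lemma generator_poly_zero_code:
  fixes emb :: "'a::field \<Rightarrow> 'b::field"
  assumes "field_hom emb" "0 < n" "\<And>z. z \<in> Z \<Longrightarrow> z ^ n = 1" "z \<in> Z"
  shows "poly (map_poly emb (generator_poly n (zero_code emb n Z))) z = 0"
proof -
  interpret field_hom emb by fact
  interpret mp: map_poly_idom_hom emb ..
  let ?f = "monom 1 n - 1 :: 'a poly"
  have "degree ?f \<noteq> 0"
    using \<open>0 < n\<close> by (simp add: degree_monom_minus_1)
  then have "?f \<noteq> 0"
    by auto
  have root: "poly (map_poly emb ?f) z = 0" if "z \<in> Z" for z
    using assms(3)[OF that] by (simp add: hom_distribs poly_monom)
  obtain g where g: "lead_coeff g = 1"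
      "\<And>p. (\<forall>z\<in>Z. poly (map_poly emb p) z = 0) \<longleftrightarrow> g dvd p"
    by (rule poly_ideal_principal[of "\<lambda>p. \<forall>z\<in>Z. poly (map_poly emb p) z = 0" ?f])
      (use \<open>?f \<noteq> 0\<close> root in \<open>simp_all add: hom_distribs\<close>)
  have dvd: "g dvd ?f"
    using root g(2) by blast
  have code: "zero_code emb n Z = ideal_code n g"
    by (simp add: set_eq_iff ideal_code_iff[OF dvd \<open>0 < n\<close>] g(2) zero_code_def eval_word_def)
  have "generator_poly n (zero_code emb n Z) = g"
    unfolding generator_poly_def
  proof (rule the_equality)
    fix h
    assume "lead_coeff h = 1 \<and> h dvd ?f \<and> zero_code emb n Z = ideal_code n h"
    then show "h = g"
      using dvd code g(1) \<open>0 < n\<close> by (intro ideal_code_inject[of h n g]) simp_all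
  qed (use dvd code g(1) in simp)
  then show ?thesis
    using g(2)[of g] \<open>z \<in> Z\<close> by simp
qed

text \<open>As \<open>monom 1 n - 1\<close> vanishes at every power of \<open>\<beta>\<close>, it
  witnesses both that the minimal polynomials exist and that they have a nonzero common
  multiple.\<close>

lemma bch_code_eq_zero_code:
  fixes emb :: "'a::field \<Rightarrow> 'b::field"
  assumes "field_hom emb" "0 < n" "\<beta> ^ n = 1"
  shows "bch_code emb n \<delta> b \<beta> = zero_code emb n ((\<lambda>i. \<beta> powi i) ` {b..b + \<delta> - 2})"
proof -
  interpret field_hom emb by fact
  interpret mp: map_poly_idom_hom emb ..
  let ?f = "monom 1 n - 1 :: 'a poly"
  let ?I = "{b..b + \<delta> - 2}"
  have "degree ?f \<noteq> 0"
    using \<open>0 < n\<close> by (simp add: degree_monom_minus_1)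
  then have "?f \<noteq> 0"
    by auto
  have "(\<beta> powi i) ^ n = 1" for i
    using \<open>\<beta> ^ n = 1\<close> by (metis power_int_1_left power_int_mult power_int_of_nat mult.commute)
  then have root: "poly (map_poly emb ?f) (\<beta> powi i) = 0" for i
    by (simp add: hom_distribs poly_monom)
  note min = min_poly_dvd_iff[OF assms(1) \<open>?f \<noteq> 0\<close> root]
  have lcm: "monic_Lcm ((\<lambda>i. min_poly emb (\<beta> powi i)) ` ?I) dvd r \<longleftrightarrow>
      (\<forall>i\<in>?I. poly (map_poly emb r) (\<beta> powi i) = 0)" for r
    using \<open>?f \<noteq> 0\<close> root by (subst monic_Lcm_dvd_iff[of ?f]) (auto simp: min)
  have dvd: "monic_Lcm ((\<lambda>i. min_poly emb (\<beta> powi i)) ` ?I) dvd ?f"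
    using root by (simp add: lcm)
  show ?thesis
    unfolding bch_code_def
    by (simp add: set_eq_iff ideal_code_iff[OF dvd \<open>0 < n\<close>] lcm zero_code_def eval_word_def)
qed

text \<open>If all the \<open>z\<close> below are roots of \<open>c\<close> and \<open>y\<close> is in the code, then for every \<open>z \<noteq> 0\<close>
  either \<open>c(z) = 0\<close> or the conjugate of \<open>y\<close> vanishes at \<open>1/z\<close>; so the Parseval sum, which is minus
  the Hermitian product, is zero. For the converse, test \<open>c\<close> against the words
  \<open>k \<mapsto> Tr(a w\<^sup>k)\<close>, where \<open>w\<close> is the \<open>q1\<close>-th root of \<open>z\<close>: they lie in the code, and their
  products with \<open>c\<close> are the values \<open>Tr(a\<^sup>q\<^sup>1 c(z))\<close>.\<close>

lemma hermitian_dual_zero_code: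
  fixes emb :: "'a::{field,finite} \<Rightarrow> 'b::{field,finite}"
  assumes "field_hom emb" "q1 = 2 ^ s" "1 < q1" "0 < m"
    and "CARD('a) = q1\<^sup>2" "CARD('b) = q1 ^ (2 * m)" "n = CARD('b) - 1" "0 \<notin> B"
  shows "hermitian_dual q1 n (zero_code emb n B) =
    zero_code emb n {z. z \<noteq> 0 \<and> (\<forall>l. inverse (z ^ (q1 ^ (2 * l + 1))) \<notin> B)}"
    (is "_ = zero_code emb n ?Z")
proof -
  interpret field_hom emb by fact
  have "s \<noteq> 0"
    using assms(2,3) by (cases s) auto
  then have two: "(2::'b) = 0"
    by (intro two_eq_0_if_even_card) (use assms(2,4,6) in auto)
  have frob: "(\<Sum>i\<in>A. f i) ^ (q1 ^ k) = (\<Sum>i\<in>A. f i ^ (q1 ^ k))"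
    for f :: "nat \<Rightarrow> 'b" and A and k
    using sum_power_two_power[OF two, of f A "s * k"] assms(2) by (simp add: power_mult)
  have fix_a: "emb x ^ (q1 ^ (2 * k)) = emb x" for x k
  proof (induction k)
    case (Suc k)
    have "emb x ^ (q1 ^ (2 * Suc k)) = (emb x ^ (q1 ^ (2 * k))) ^ CARD('a)"
      by (simp add: assms(5) power2_eq_square mult_ac flip: power_mult)
    also have "\<dots> = emb x"
      using Suc by (simp add: finite_field_power_card flip: hom_power)
    finally show ?case .
  qed simp
  have fix_b: "x ^ (q1 ^ (2 * m)) = x" for x :: 'b
    using finite_field_power_card[of x] assms(6) by simp
  have unity: "x ^ n = 1" if "x \<noteq> 0" for x :: 'b
    using finite_field_power_card_minus_1[OF that] assms(7) by simp
  have emb_prod: "emb (hermitian_prod q1 c y) = (\<Sum>k<n. emb (c $ k) * emb (y $ k) ^ q1)"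
    if "y \<in> carrier_vec n" for c y
    using that by (simp add: hermitian_prod_def hom_distribs)
  show ?thesis
  proof (intro equalityI subsetI)
    fix c assume c: "c \<in> zero_code emb n ?Z"
    then have [simp]: "c \<in> carrier_vec n"
      by (simp add: zero_code_def)
    have "hermitian_prod q1 c y = 0" if "y \<in> zero_code emb n B" for y
    proof -
      have y: "y \<in> carrier_vec n" "\<And>b. b \<in> B \<Longrightarrow> eval_word emb y b = 0"
        using that by (auto simp: zero_code_def)
      define Y where "Y z = (\<Sum>k<n. emb (y $ k) ^ q1 * inverse z ^ k)" for z
      have vanish: "eval_word emb c z * Y z = 0" if "z \<noteq> 0" for z
      proof (cases "z \<in> ?Z")
        case True
        with c show ?thesis
          by (simp add: zero_code_def)
      next
        case False
        then obtain l where l: "inverse (z ^ (q1 ^ (2 * l + 1))) \<in> B"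
          using \<open>z \<noteq> 0\<close> by auto
        \<comment> \<open>This power undoes the conjugation: the coefficients receive the exponent
          \<open>q1 ^ (2 * (l + 1))\<close>, which fixes the base field, and the point becomes the
          element of \<open>B\<close>.\<close>
        have "Y z ^ (q1 ^ (2 * l + 1)) =
            (\<Sum>k<n. (emb (y $ k) ^ q1 * inverse z ^ k) ^ (q1 ^ (2 * l + 1)))"
          unfolding Y_def by (rule frob)
        also have "\<dots> = (\<Sum>k<n. emb (y $ k) * inverse (z ^ (q1 ^ (2 * l + 1))) ^ k)"
        proof (intro sum.cong refl)
          fix k
          have "(emb (y $ k) ^ q1) ^ (q1 ^ (2 * l + 1)) = emb (y $ k) ^ (q1 ^ (2 * (l + 1)))"
            by (simp flip: power_mult)
          also have "\<dots> = emb (y $ k)"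
            by (rule fix_a)
          finally show "(emb (y $ k) ^ q1 * inverse z ^ k) ^ (q1 ^ (2 * l + 1)) =
              emb (y $ k) * inverse (z ^ (q1 ^ (2 * l + 1))) ^ k"
            by (simp add: power_mult_distrib power_inverse mult.commute flip: power_mult)
        qed
        also have "\<dots> = 0"
          using y(2)[OF l] eval_word_eq_sum[OF assms(1) y(1)] by simp
        finally have "Y z = 0"
          by simp
        then show ?thesis
          by simp
      qed
      have "0 = (\<Sum>z\<in>- {0}. eval_word emb c z * Y z)"
        by (simp add: vanish)
      also have "\<dots> = (\<Sum>z\<in>- {0}. \<Sum>k<n. \<Sum>l<n. emb (c $ k) * emb (y $ l) ^ q1 * (z ^ k * inverse z ^ l))"
        by (simp add: eval_word_eq_sum[OF assms(1) \<open>c \<in> carrier_vec n\<close>] Y_def sum_product mult_ac)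
      also have "\<dots> = (\<Sum>k<n. \<Sum>l<n. emb (c $ k) * emb (y $ l) ^ q1 * (\<Sum>z\<in>- {0}. z ^ k * inverse z ^ l))"
        by (subst sum.swap, intro sum.cong refl, subst sum.swap) (simp add: sum_distrib_left)
      also have "\<dots> = (\<Sum>k<n. \<Sum>l<n. if k = l then - (emb (c $ k) * emb (y $ l) ^ q1) else 0)"
        using assms(7) by (intro sum.cong refl) (subst sum_nonzero_power_orthogonal, auto)
      also have "\<dots> = - emb (hermitian_prod q1 c y)"
        by (simp add: emb_prod[OF y(1)] sum_negf)
      finally show ?thesis
        by simp
    qed
    then show "c \<in> hermitian_dual q1 n (zero_code emb n B)"
      by (simp add: hermitian_dual_def)
  next
    fix c assume c: "c \<in> hermitian_dual q1 n (zero_code emb n B)"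
    then have [simp]: "c \<in> carrier_vec n"
      by (simp add: hermitian_dual_def)
    have "eval_word emb c z = 0" if z: "z \<in> ?Z" for z
    proof (rule trace_form_nondegenerate)
      show "CARD('b) = (q1\<^sup>2) ^ m" "0 < m" "1 < q1\<^sup>2"
        using assms(3,4,6) one_less_power[of q1 2] by (simp_all flip: power_mult)
      fix a :: 'b
      \<comment> \<open>Powers with exponent \<open>q1 ^ (2 * m)\<close> are trivial, so the
        exponent \<open>q1 ^ (2 * m - 1)\<close> extracts \<open>q1\<close>-th roots. Taking the
        root of \<open>a\<close> as well makes the final trace that of \<open>a\<close> times the
        value of \<open>c\<close> at \<open>z\<close>.\<close>
      define w where "w = z ^ (q1 ^ (2 * m - 1))"
      define a' where "a' = a ^ (q1 ^ (2 * m - 1))"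
      have "q1 ^ (2 * m) = q1 ^ (2 * m - 1) * q1"
        using assms(4) by (simp flip: power_Suc2)
      then have w: "w ^ q1 = z" and a': "a' ^ q1 = a"
        using fix_b by (simp_all add: w_def a'_def flip: power_mult)
      define tr where "tr k = (\<Sum>l<m. (a' * w ^ k) ^ (q1 ^ (2 * l)))" for k
      have "tr k \<in> range emb" for k
      proof (rule frobenius_fixed_in_range[OF assms(1)])
        have "tr k ^ CARD('a) = (\<Sum>l<m. ((a' * w ^ k) ^ (q1 ^ (2 * l))) ^ (q1 ^ 2))"
          unfolding tr_def assms(5) by (rule frob)
        also have "\<dots> = (\<Sum>l<m. (a' * w ^ k) ^ (q1 ^ (2 * Suc l)))"
          by (simp flip: power_mult power_add)
        also have "\<dots> = (\<Sum>l<m. (a' * w ^ k) ^ (q1 ^ (2 * l)))"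
        proof -
          \<comment> \<open>Frobenius permutes the conjugates cyclically: the one with index
            \<open>m\<close> equals the one with index 0, and both cancel.\<close>
          have "(\<Sum>l<m. (a' * w ^ k) ^ (q1 ^ (2 * Suc l))) + (a' * w ^ k) ^ (q1 ^ (2 * 0)) =
              (\<Sum>l<Suc m. (a' * w ^ k) ^ (q1 ^ (2 * l)))"
            by (subst sum.lessThan_Suc_shift) simp
          also have "\<dots> = (\<Sum>l<m. (a' * w ^ k) ^ (q1 ^ (2 * l))) + a' * w ^ k"
            using fix_b by simp
          finally show ?thesis
            by simp
        qed
        finally show "tr k ^ CARD('a) = tr k"
          by (simp only: tr_def)
      qed
      define y where "y k = inv_into UNIV emb (tr k)" for k
      have y: "emb (y k) = tr k" for k
        unfolding y_def using \<open>tr k \<in> range emb\<close> by (rule f_inv_into_f)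
      have "eval_word emb (vec n y) b = 0" if "b \<in> B" for b
      proof -
        have "eval_word emb (vec n y) b = (\<Sum>k<n. tr k * b ^ k)"
          by (simp add: eval_word_eq_sum[OF assms(1), of _ n] y)
        also have "\<dots> = (\<Sum>k<n. \<Sum>l<m. a' ^ (q1 ^ (2 * l)) * (w ^ (q1 ^ (2 * l)) * b) ^ k)"
        proof -
          have "(a' * w ^ k) ^ N * b ^ k = a' ^ N * (w ^ N * b) ^ k" for k N
            by (simp add: power_mult_distrib mult_ac flip: power_mult)
          then show ?thesis
            by (simp only: tr_def sum_distrib_right)
        qed
        also have "\<dots> = (\<Sum>l<m. a' ^ (q1 ^ (2 * l)) * (\<Sum>k<n. (w ^ (q1 ^ (2 * l)) * b) ^ k))"
          by (subst sum.swap) (simp add: sum_distrib_left)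
        also have "\<dots> = 0"
        proof (intro sum.neutral ballI)
          fix l
          \<comment> \<open>The total exponent of \<open>q1\<close> is odd, so
            \<open>z \<in> ?Z\<close> excludes that the ratio of the geometric sum is 1.\<close>
          have "w ^ (q1 ^ (2 * l)) = z ^ (q1 ^ (2 * (m - 1 + l) + 1))"
          proof -
            have "2 * (m - 1 + l) + 1 = (2 * m - 1) + 2 * l"
              using assms(4) by simp
            then show ?thesis
              by (simp only: w_def power_add flip: power_mult)
          qed
          then have "w ^ (q1 ^ (2 * l)) * b \<noteq> 1"
            using z \<open>b \<in> B\<close> by (metis (mono_tags, lifting) inverse_unique mem_Collect_eq)
          moreover have "w ^ (q1 ^ (2 * l)) * b \<noteq> 0"
            using z \<open>b \<in> B\<close> assms(8) by (auto simp: w_def)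
          ultimately show "a' ^ (q1 ^ (2 * l)) * (\<Sum>k<n. (w ^ (q1 ^ (2 * l)) * b) ^ k) = 0"
            by (simp add: sum_powers_root_of_unity unity)
        qed
        finally show ?thesis .
      qed
      then have "vec n y \<in> zero_code emb n B"
        by (simp add: zero_code_def)
      then have "0 = emb (hermitian_prod q1 c (vec n y))"
        using c by (simp add: hermitian_dual_def)
      also have "\<dots> = (\<Sum>k<n. emb (c $ k) * tr k ^ q1)"
        by (simp add: emb_prod y)
      also have "\<dots> = (\<Sum>k<n. emb (c $ k) * (\<Sum>l<m. (a * z ^ k) ^ (q1 ^ (2 * l))))"
      proof (intro sum.cong refl arg_cong2[of _ _ _ _ "(*)"])
        fix k
        have "tr k ^ (q1 ^ 1) = (\<Sum>l<m. ((a' * w ^ k) ^ (q1 ^ (2 * l))) ^ (q1 ^ 1))"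
          unfolding tr_def by (rule frob)
        also have "\<dots> = (\<Sum>l<m. ((a' * w ^ k) ^ q1) ^ (q1 ^ (2 * l)))"
          by (simp add: mult.commute flip: power_mult)
        also have "(a' * w ^ k) ^ q1 = a * z ^ k"
          using a' w by (metis power_mult_distrib power_mult mult.commute)
        finally show "tr k ^ q1 = (\<Sum>l<m. (a * z ^ k) ^ (q1 ^ (2 * l)))"
          by simp
      qed
      \<comment> \<open>The coefficients of \<open>c\<close> are fixed by the even Frobenius powers
        and can move inside, which assembles the value of \<open>c\<close> at
        \<open>z\<close>.\<close>
      also have "\<dots> = (\<Sum>l<m. \<Sum>k<n. (a * (emb (c $ k) * z ^ k)) ^ (q1 ^ (2 * l)))"
      proof -
        have "emb (c $ k) * (a * z ^ k) ^ (q1 ^ (2 * l)) = (a * (emb (c $ k) * z ^ k)) ^ (q1 ^ (2 * l))"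
          for k l
          by (simp add: power_mult_distrib fix_a)
        then show ?thesis
          unfolding sum_distrib_left by (subst sum.swap) (simp only:)
      qed
      also have "\<dots> = (\<Sum>l<m. (a * eval_word emb c z) ^ (q1 ^ (2 * l)))"
        by (simp add: eval_word_eq_sum[OF assms(1), of c n] sum_distrib_left frob)
      finally show "(\<Sum>l<m. (a * eval_word emb c z) ^ (q1\<^sup>2) ^ l) = 0"
        by (simp add: power_mult)
    qed
    then show "c \<in> zero_code emb n ?Z"
      by (simp add: zero_code_def)
  qed
qed

section \<open>The defining set of the Hermitian dual of a BCH code\<close>

lemma primitive_root_power_eq_1_iff:
  assumes "primitive_root_of_unity n \<beta>" "0 < n"
  shows "\<beta> ^ k = 1 \<longleftrightarrow> n dvd k"
proof
  assume "\<beta> ^ k = 1"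
  have "\<beta> ^ k = (\<beta> ^ n) ^ (k div n) * \<beta> ^ (k mod n)"
    by (simp flip: power_mult power_add)
  then have "\<beta> ^ (k mod n) = 1"
    using \<open>\<beta> ^ k = 1\<close> assms(1) by (simp add: primitive_root_of_unity_def)
  then show "n dvd k"
    using assms by (auto simp: primitive_root_of_unity_def dvd_eq_mod_eq_0)
next
  assume "n dvd k"
  then show "\<beta> ^ k = 1"
    using assms(1) by (auto simp: primitive_root_of_unity_def power_mult elim!: dvdE)
qed

lemma hermitian_dual_bch_defining_set:
  fixes emb :: "'a::{field,finite} \<Rightarrow> 'b::{field,finite}" and q1 m n :: nat and \<delta> :: int
  assumes "field_hom emb" "q1 = 2 ^ s" "1 < q1" "0 < m"
    and "CARD('a) = q1\<^sup>2" "CARD('b) = q1 ^ (2 * m)" "n = q1 ^ (2 * m) - 1"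
    and "primitive_root_of_unity n \<beta>" "i < n"
    and avoid: "\<And>r t. odd r \<Longrightarrow> r < 2 * m \<Longrightarrow> 0 < t \<Longrightarrow> int t < \<delta> \<Longrightarrow> \<not> n dvd i * q1 ^ r + t"
  shows "i \<in> defining_set emb n \<beta> (generator_poly n (hermitian_dual q1 n (bch_code emb n \<delta> 1 \<beta>)))"
proof -
  define B where "B = (\<lambda>i. \<beta> powi i) ` {1..1 + \<delta> - 2}"
  define Z where "Z = {z. z \<noteq> 0 \<and> (\<forall>l. inverse (z ^ (q1 ^ (2 * l + 1))) \<notin> B)}"
  have "0 < n" and \<beta>n: "\<beta> ^ n = 1"
    using assms(8,9) by (auto simp: primitive_root_of_unity_def)
  then have "\<beta> \<noteq> 0"
    by (auto simp: zero_power)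
  have "bch_code emb n \<delta> 1 \<beta> = zero_code emb n B"
    unfolding B_def using assms(1) \<open>0 < n\<close> \<beta>n by (rule bch_code_eq_zero_code)
  moreover have "0 \<notin> B"
    using \<open>\<beta> \<noteq> 0\<close> by (auto simp: B_def)
  then have "hermitian_dual q1 n (zero_code emb n B) = zero_code emb n Z"
    unfolding Z_def using assms by (intro hermitian_dual_zero_code[of emb q1 s m n B]) simp_all
  ultimately have "hermitian_dual q1 n (bch_code emb n \<delta> 1 \<beta>) = zero_code emb n Z"
    by simp
  moreover have "\<beta> ^ i \<in> Z"
  proof -
    have "inverse ((\<beta> ^ i) ^ (q1 ^ (2 * l + 1))) \<notin> B" for l
    proof
      assume "inverse ((\<beta> ^ i) ^ (q1 ^ (2 * l + 1))) \<in> B"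
      then obtain t' where t': "t' \<in> {1..1 + \<delta> - 2}"
          "inverse ((\<beta> ^ i) ^ (q1 ^ (2 * l + 1))) = \<beta> powi t'"
        by (auto simp: B_def)
      define t where "t = nat t'"
      have t: "0 < t" "int t < \<delta>" "inverse ((\<beta> ^ i) ^ (q1 ^ (2 * l + 1))) = \<beta> ^ t"
        using t' by (auto simp: t_def power_int_def)
      \<comment> \<open>Rotating by \<open>2 * m\<close> places changes nothing, so finitely many
        exponents suffice; the even modulus keeps \<open>r\<close> odd.\<close>
      define r where "r = (2 * l + 1) mod (2 * m)"
      have "q1 ^ (2 * l + 1) = CARD('b) ^ ((2 * l + 1) div (2 * m)) * q1 ^ r"
        unfolding r_def assms(6) by (simp only: mult_div_mod_eq flip: power_mult power_add)
      then have "(\<beta> ^ i) ^ (q1 ^ (2 * l + 1)) = \<beta> ^ (i * q1 ^ r)"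
        by (simp only: power_mult finite_field_power_card_power)
      then have "\<beta> ^ (i * q1 ^ r + t) = 1"
        using t(3) \<open>\<beta> \<noteq> 0\<close> by (simp add: power_add flip: t(3))
      then have "n dvd i * q1 ^ r + t"
        using primitive_root_power_eq_1_iff[OF assms(8) \<open>0 < n\<close>] by simp
      moreover have "odd r"
        unfolding r_def by (simp add: dvd_mod_iff)
      ultimately show False
        using avoid[OF _ _ t(1,2), of r] assms(4) by (simp add: r_def)
    qed
    then show ?thesis
      using \<open>\<beta> \<noteq> 0\<close> by (simp add: Z_def)
  qed
  moreover have "z ^ n = 1" if "z \<in> Z" for z
    using that finite_field_power_card_minus_1[of z] assms(6,7) by (simp add: Z_def)
  ultimately show ?thesis
    using generator_poly_zero_code[OF assms(1) \<open>0 < n\<close>, of Z "\<beta> ^ i"] assms(9)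
    by (simp add: defining_set_def)
qed

theorem theorem8:
  fixes emb :: "'a::{field,finite} \<Rightarrow> 'b::{field,finite}"
    and \<beta> :: 'b and q1 q m n :: nat and \<delta> :: int
    and g_dual :: "'a poly" and T :: "nat set"
  assumes "\<exists>s\<ge>1. q1 = 2 ^ s"
    and "q = q1\<^sup>2"
    and "even m" and "m > 0"
    and "n = q ^ m - 1"
    and "CARD('a) = q" and "CARD('b) = q ^ m" and "field_hom emb"
    and "primitive_root_of_unity n \<beta>"
    and "\<delta> = int q1 ^ (m + 1) - 2 * (int q1)\<^sup>2 + 1" and "\<delta> \<ge> 2"
    and "g_dual = generator_poly n (hermitian_dual q1 n (bch_code emb n \<delta> 1 \<beta>))"
    and "T = defining_set emb n \<beta> g_dual"
  shows "(m \<ge> 4 \<longrightarrow>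
            {0..q1 ^ (m + 1) - q1\<^sup>2} \<union> {q1 ^ (m + 1)..2 * q1 ^ (m + 1) - q1\<^sup>2} \<subseteq> T) \<and>
         (q1 \<ge> 4 \<and> m = 2 \<longrightarrow>
            {0..q1 ^ 3 - q1\<^sup>2 + 2 * q1 - 1} \<union> {q1 ^ 3..2 * q1 ^ 3 - q1\<^sup>2 + 2 * q1 - 1} \<subseteq> T)"
proof -
  obtain s where s: "1 \<le> s" "q1 = 2 ^ s"
    using assms(1) by blast
  have q1: "2 \<le> q1"
    using s power_increasing[of 1 s "2::nat"] by simp
  have qm: "q ^ m = q1 ^ (2 * m)"
    using assms(2) by (simp add: power_mult)
  \<comment> \<open>The final \<open>+ 1\<close> in \<open>\<delta>\<close> turns the strict
    inequality into this weak one, now over the naturals.\<close>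
  have t_bound: "t + 2 * q1\<^sup>2 \<le> q1 ^ (m + 1)" if "int t < \<delta>" for t
  proof -
    have "int (t + 2 * q1\<^sup>2) \<le> int (q1 ^ (m + 1))"
      using that assms(10) by simp
    then show ?thesis
      by (simp only: of_nat_le_iff)
  qed
  have in_T: "i \<in> T" if "i < n"
      "\<And>r t. odd r \<Longrightarrow> r < 2 * m \<Longrightarrow> 0 < t \<Longrightarrow> t + 2 * q1\<^sup>2 \<le> q1 ^ (m + 1) \<Longrightarrow> \<not> n dvd i * q1 ^ r + t"
    for i
    unfolding assms(12,13)
    by (rule hermitian_dual_bch_defining_set[where s = s and m = m])
      (use assms s q1 qm that t_bound in auto)
  \<comment> \<open>The second range is the first one shifted by \<open>q1 ^ (m + 1)\<close>;
    \<open>e = 1\<close> marks the shift.\<close>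
  have split: "\<exists>e j. i = e * q1 ^ (m + 1) + j \<and> e \<le> 1 \<and> j \<le> J"
    if "i \<in> {0..J} \<union> {q1 ^ (m + 1)..q1 ^ (m + 1) + J}" for i J
  proof (cases "i \<le> J")
    case True
    then show ?thesis
      by (intro exI[of _ 0] exI[of _ i]) simp
  next
    case False
    with that show ?thesis
      by (intro exI[of _ 1] exI[of _ "i - q1 ^ (m + 1)"]) auto
  qed
  show ?thesis
  proof (intro conjI impI subsetI)
    fix i assume m: "4 \<le> m" and i: "i \<in> {0..q1 ^ (m + 1) - q1\<^sup>2} \<union> {q1 ^ (m + 1)..2 * q1 ^ (m + 1) - q1\<^sup>2}"
    have le: "q1\<^sup>2 \<le> q1 ^ (m + 1)"
      using q1 m by (intro power_increasing) auto
    then have "2 * q1 ^ (m + 1) - q1\<^sup>2 = q1 ^ (m + 1) + (q1 ^ (m + 1) - q1\<^sup>2)"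
      by linarith
    then obtain e j where ej: "i = e * q1 ^ (m + 1) + j" "e \<le> 1" "j \<le> q1 ^ (m + 1) - q1\<^sup>2"
      using split[of i "q1 ^ (m + 1) - q1\<^sup>2"] i by metis
    then have j: "j + q1\<^sup>2 \<le> q1 ^ (m + 1)"
      using le by simp
    have "i + q1\<^sup>2 \<le> 2 * q1 ^ (m + 1)"
      using mult_le_mono1[OF ej(2), of "q1 ^ (m + 1)"] j unfolding ej(1) by linarith
    also have "\<dots> \<le> q1 ^ (m + 2)"
      using q1 by simp
    also have "\<dots> \<le> q1 ^ (2 * m)"
      using q1 m by (intro power_increasing) auto
    \<comment> \<open>The slack \<open>q1\<^sup>2\<close>, at least 4, absorbs the
      \<open>- 1\<close> in \<open>n\<close>.\<close>
    finally have "i < n"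
      using q1 power_mono[OF q1, of 2] assms(5) qm by simp
    then show "i \<in> T"
      using rotation_avoids_low_range[OF q1 m assms(3) _ _ ej(2) j] assms(5) qm ej(1)
      by (intro in_T) auto
  next
    fix i assume m: "4 \<le> q1 \<and> m = 2"
      and i: "i \<in> {0..q1 ^ 3 - q1\<^sup>2 + 2 * q1 - 1} \<union> {q1 ^ 3..2 * q1 ^ 3 - q1\<^sup>2 + 2 * q1 - 1}"
    \<comment> \<open>These bounds ensure that no subtraction in the ranges is truncated.\<close>
    have le: "4 * q1\<^sup>2 \<le> q1 ^ 3" "4 * q1 ^ 3 \<le> q1 ^ 4" "4 * q1 \<le> q1\<^sup>2"
      using m by (simp_all add: power_numeral_reduce)
    have "2 * q1 ^ 3 - q1\<^sup>2 + 2 * q1 - 1 = q1 ^ 3 + (q1 ^ 3 - q1\<^sup>2 + 2 * q1 - 1)" "q1 ^ (m + 1) = q1 ^ 3"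
      using le m by simp_all
    then obtain e j where ej: "i = e * q1 ^ 3 + j" "e \<le> 1" "j \<le> q1 ^ 3 - q1\<^sup>2 + 2 * q1 - 1"
      using split[of i "q1 ^ 3 - q1\<^sup>2 + 2 * q1 - 1"] i by metis
    then have j: "j + q1\<^sup>2 + 1 \<le> q1 ^ 3 + 2 * q1"
      using le m by linarith
    have "i + q1\<^sup>2 + 1 \<le> 2 * q1 ^ 3 + 2 * q1"
      using mult_le_mono1[OF ej(2), of "q1 ^ 3"] j unfolding ej(1) by linarith
    then have "i < n"
      using le m assms(5) qm by simp
    then show "i \<in> T"
      using rotation_avoids_low_range_2[OF _ _ _ ej(2) j] assms(5) qm ej(1) m
      by (intro in_T) auto
  qed
qed

end
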